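(* Let $\mathbf G$ be a vertex-edge random graph on $n$ vertices and let $\varepsilon>0$. Then there exists a vertex random graph $\widehat{\mathbf G}$ on $n$ vertices with $d_{\mathrm{TV}}(\mathbf G,\widehat{\mathbf G})<\varepsilon$.
   Context: For a positive integer $n$, let $\mathcal G_n$ be the set of simple graphs with vertex set $[n]=\{1,\dots,n\}$. A random graph is a probability measure $P$ on $\mathcal G_n$. Given a probability space $(\mathcal X,\mu)$ and a symmetric measurable function $\phi:\mathcal X\times\mathcal X\to[0,1]$, the vertex-edge random graph $\mathbf G(n,\mathcal X,\mu,\phi)$ is the random graph obtained by drawing $X_1,\dots,X_n$ i.i.d. with law $\mu$ and then, conditionally on $(X_1,\dots,X_n)$, independently for each pair $i<j$ including the edge $ij$ with probability $\phi(X_i,X_j)$; i.e. $P(G)=\int \prod_{i<j,\,ij\in E(G)}\phi(x_i,x_j)\prod_{i<j,\,ij\notin E(G)}(1-\phi(x_i,x_j))\,\mu(dx_1)\cdots\mu(dx_n)$. A vertex random graph is a vertex-edge random graph $\mathbf G(n,\mathcal X,\mu,\phi)$ in which $\phi$ takes values in $\{0,1\}$. For random graphs $\mathbf G_1=(\mathcal G_n,P_1)$, $\mathbf G_2=(\mathcal G_n,P_2)$, the total variation distance is $d_{\mathrm{TV}}(\mathbf G_1,\mathbf G_2)=\frac12\sum_{G\in\mathcal G_n}|P_1(G)-P_2(G)|$. *)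

theory Defs
  imports "HOL-Probability.Probability"
begin

(* A simple graph with vertex set [n] = {1..n} is represented by its edge set, a set of
   two-element subsets of {1..n}. *)
type_synonym edge_set = "nat set set"

definition simple_graphs :: "nat \<Rightarrow> edge_set set" where
  "simple_graphs n = {E. \<forall>e\<in>E. e \<subseteq> {1..n} \<and> card e = 2}"

definition vertex_pairs :: "nat \<Rightarrow> (nat \<times> nat) set" where
  "vertex_pairs n = {(i, j). 1 \<le> i \<and> i < j \<and> j \<le> n}"

definition random_graph :: "nat \<Rightarrow> edge_set measure \<Rightarrow> bool" where
  "random_graph n P \<longleftrightarrow>
     prob_space P \<and> space P = simple_graphs n \<and> sets P = Pow (simple_graphs n)"

locale vertex_edge_kernel = prob_space M for M :: "'a measure" +
  fixes \<phi> :: "'a \<Rightarrow> 'a \<Rightarrow> real"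
  assumes kernel_measurable: "case_prod \<phi> \<in> borel_measurable (M \<Otimes>\<^sub>M M)"
    and kernel_sym: "\<And>x y. x \<in> space M \<Longrightarrow> y \<in> space M \<Longrightarrow> \<phi> x y = \<phi> y x"
    and kernel_range: "\<And>x y. x \<in> space M \<Longrightarrow> y \<in> space M \<Longrightarrow> \<phi> x y \<in> {0..1}"

locale vertex_kernel = vertex_edge_kernel +
  assumes kernel_zero_one: "\<And>x y. x \<in> space M \<Longrightarrow> y \<in> space M \<Longrightarrow> \<phi> x y \<in> {0, 1}"

(* The conditional probability of the graph E given that the vertices have types x 1, ..., x n. *)
definition conditional_graph_prob ::
  "nat \<Rightarrow> ('a \<Rightarrow> 'a \<Rightarrow> real) \<Rightarrow> (nat \<Rightarrow> 'a) \<Rightarrow> edge_set \<Rightarrow> real" where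
  "conditional_graph_prob n \<phi> x E =
     (\<Prod>(i, j)\<in>{(i, j)\<in>vertex_pairs n. {i, j} \<in> E}. \<phi> (x i) (x j)) *
     (\<Prod>(i, j)\<in>{(i, j)\<in>vertex_pairs n. {i, j} \<notin> E}. 1 - \<phi> (x i) (x j))"

definition graph_prob ::
  "nat \<Rightarrow> 'a measure \<Rightarrow> ('a \<Rightarrow> 'a \<Rightarrow> real) \<Rightarrow> edge_set \<Rightarrow> real" where
  "graph_prob n M \<phi> E =
     (\<integral>x. conditional_graph_prob n \<phi> x E \<partial>(\<Pi>\<^sub>M i\<in>{1..n}. M))"

definition vertex_edge_random_graph ::
  "nat \<Rightarrow> 'a measure \<Rightarrow> ('a \<Rightarrow> 'a \<Rightarrow> real) \<Rightarrow> edge_set measure" where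
  "vertex_edge_random_graph n M \<phi> =
     point_measure (simple_graphs n) (\<lambda>E. ennreal (graph_prob n M \<phi> E))"

definition tv_dist :: "nat \<Rightarrow> edge_set measure \<Rightarrow> edge_set measure \<Rightarrow> real" where
  "tv_dist n P Q = (1/2) * (\<Sum>E\<in>simple_graphs n. \<bar>measure P {E} - measure Q {E}\<bar>)"

(* A random graph counts as a vertex(-edge) random graph when its law is that of some kernel.
   HOL cannot quantify over types, so the type of vertex labels is a parameter; the underlying
   set and sigma-algebra are arbitrary within that type. *)
definition is_vertex_edge_random_graph :: "'a itself \<Rightarrow> nat \<Rightarrow> edge_set measure \<Rightarrow> bool" where
  "is_vertex_edge_random_graph _ n P \<longleftrightarrow>
     (\<exists>(M :: 'a measure) \<phi>. vertex_edge_kernel M \<phi> \<and> P = vertex_edge_random_graph n M \<phi>)"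

definition is_vertex_random_graph :: "'a itself \<Rightarrow> nat \<Rightarrow> edge_set measure \<Rightarrow> bool" where
  "is_vertex_random_graph _ n P \<longleftrightarrow>
     (\<exists>(M :: 'a measure) \<phi>. vertex_kernel M \<phi> \<and> P = vertex_edge_random_graph n M \<phi>)"

lemma finite_simple_graphs: "finite (simple_graphs n)"
proof (rule finite_subset)
  show "simple_graphs n \<subseteq> Pow (Pow {1..n})" by (auto simp: simple_graphs_def)
qed simp

lemma finite_vertex_pairs: "finite (vertex_pairs n)"
proof (rule finite_subset)
  show "vertex_pairs n \<subseteq> {1..n} \<times> {1..n}" by (auto simp: vertex_pairs_def)
qed simp

lemma sum_conditional_graph_prob:
  "(\<Sum>E\<in>simple_graphs n. conditional_graph_prob n \<phi> x E) = 1"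
proof -
  let ?V = "vertex_pairs n" and ?e = "\<lambda>(i::nat, j). {i, j}"
  have e2: "\<exists>p\<in>?V. e = ?e p" if e: "e \<subseteq> {1..n}" "card e = 2" for e
  proof -
    obtain i j where ij: "e = {i, j}" "i \<noteq> j" using e(2) by (auto simp: card_2_iff)
    show ?thesis
    proof (cases "i < j")
      case True
      then show ?thesis using e ij by (intro bexI[of _ "(i, j)"]) (auto simp: vertex_pairs_def)
    next
      case False
      then show ?thesis using e ij by (intro bexI[of _ "(j, i)"]) (auto simp: vertex_pairs_def)
    qed
  qed
  have inj: "inj_on ?e ?V"
    by (auto simp: inj_on_def vertex_pairs_def doubleton_eq_iff)
  have img: "?e ` ?V = {e. e \<subseteq> {1..n} \<and> card e = 2}"
  proof (intro equalityI subsetI)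
    fix e assume "e \<in> ?e ` ?V"
    then show "e \<in> {e. e \<subseteq> {1..n} \<and> card e = 2}" by (auto simp: vertex_pairs_def)
  next
    fix e assume "e \<in> {e. e \<subseteq> {1..n} \<and> card e = 2}"
    then show "e \<in> ?e ` ?V" using e2[of e] by auto
  qed
  have graphs: "simple_graphs n = Pow (?e ` ?V)"
    unfolding img by (auto simp: simple_graphs_def)
  have bij: "bij_betw ((`) ?e) (Pow ?V) (simple_graphs n)"
    unfolding graphs using inj by (simp add: bij_betw_Pow bij_betw_imageI)
  have "(\<Sum>E\<in>simple_graphs n. conditional_graph_prob n \<phi> x E)
      = (\<Sum>B\<in>Pow ?V. conditional_graph_prob n \<phi> x (?e ` B))"
    by (rule sum.reindex_bij_betw[OF bij, symmetric])
  also have "\<dots> = (\<Sum>B\<in>Pow ?V. prod (\<lambda>(i, j). \<phi> (x i) (x j)) B *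
      prod (\<lambda>p. 1 - (\<lambda>(i, j). \<phi> (x i) (x j)) p) (?V - B))"
  proof (rule sum.cong[OF refl])
    fix B assume "B \<in> Pow ?V"
    then have mem: "?e p \<in> ?e ` B \<longleftrightarrow> p \<in> B" if "p \<in> ?V" for p
      using inj_on_image_mem_iff[OF inj, of p B] that by auto
    have "{(i, j)\<in>?V. {i, j} \<in> ?e ` B} = B" "{(i, j)\<in>?V. {i, j} \<notin> ?e ` B} = ?V - B"
      using mem \<open>B \<in> Pow ?V\<close> by fastforce+
    then show "conditional_graph_prob n \<phi> x (?e ` B) = prod (\<lambda>(i, j). \<phi> (x i) (x j)) B *
        prod (\<lambda>p. 1 - (\<lambda>(i, j). \<phi> (x i) (x j)) p) (?V - B)"
      by (simp add: conditional_graph_prob_def case_prod_unfold)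
  qed
  also have "\<dots> = 1" by (subst prod_add[OF finite_vertex_pairs, symmetric]) simp
  finally show ?thesis .
qed

context vertex_edge_kernel
begin

lemma conditional_graph_prob_bounds:
  assumes "x \<in> space (\<Pi>\<^sub>M i\<in>{1..n}. M)"
  shows "conditional_graph_prob n \<phi> x E \<in> {0..1}"
proof -
  have "x i \<in> space M" if "i \<in> {1..n}" for i using assms that by (auto simp: space_PiM)
  then have r: "\<phi> (x i) (x j) \<in> {0..1}" if "(i, j) \<in> vertex_pairs n" for i j
    using that by (intro kernel_range) (auto simp: vertex_pairs_def)
  then show ?thesis
    unfolding conditional_graph_prob_def atLeastAtMost_iff
    by (intro conjI mult_nonneg_nonneg mult_le_one prod_nonneg prod_le_1) auto
qed

lemma conditional_graph_prob_measurable: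
  "(\<lambda>x. conditional_graph_prob n \<phi> x E) \<in> borel_measurable (\<Pi>\<^sub>M i\<in>{1..n}. M)"
proof -
  have "(\<lambda>x. \<phi> (x i) (x j)) \<in> borel_measurable (\<Pi>\<^sub>M i\<in>{1..n}. M)"
    if "(i, j) \<in> vertex_pairs n" for i j
  proof -
    have "i \<in> {1..n}" "j \<in> {1..n}" using that by (auto simp: vertex_pairs_def)
    then have "(\<lambda>x. (x i, x j)) \<in> (\<Pi>\<^sub>M i\<in>{1..n}. M) \<rightarrow>\<^sub>M M \<Otimes>\<^sub>M M"
      by (intro measurable_Pair measurable_component_singleton)
    from measurable_compose[OF this kernel_measurable] show ?thesis by simp
  qed
  then show ?thesis
    unfolding conditional_graph_prob_def
    by (intro borel_measurable_times borel_measurable_prod) (auto simp: case_prod_unfold)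
qed

lemma graph_prob_nonneg: "0 \<le> graph_prob n M \<phi> E"
  unfolding graph_prob_def
  using conditional_graph_prob_bounds by (intro integral_nonneg_AE AE_I2) auto

lemma sum_graph_prob: "(\<Sum>E\<in>simple_graphs n. graph_prob n M \<phi> E) = 1"
proof -
  interpret P: prob_space "\<Pi>\<^sub>M i\<in>{1..n}. M"
    by (intro prob_space_PiM prob_space_axioms)
  have "integrable (\<Pi>\<^sub>M i\<in>{1..n}. M) (\<lambda>x. conditional_graph_prob n \<phi> x E)" for E
    using conditional_graph_prob_bounds[of _ n E]
    by (intro P.integrable_const_bound[of _ 1] AE_I2 conditional_graph_prob_measurable) auto
  then show ?thesis
    unfolding graph_prob_def
    by (subst Bochner_Integration.integral_sum[symmetric])
      (simp_all only: sum_conditional_graph_prob lebesgue_integral_const P.prob_space scaleR_one)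
qed

lemma random_graph_vertex_edge_random_graph:
  "random_graph n (vertex_edge_random_graph n M \<phi>)"
proof -
  let ?P = "vertex_edge_random_graph n M \<phi>"
  have s: "space ?P = simple_graphs n" "sets ?P = Pow (simple_graphs n)"
    by (simp_all add: vertex_edge_random_graph_def space_point_measure sets_point_measure)
  have "emeasure ?P (space ?P) = (\<Sum>E\<in>simple_graphs n. ennreal (graph_prob n M \<phi> E))"
    unfolding s unfolding vertex_edge_random_graph_def
    by (rule emeasure_point_measure_finite[OF finite_simple_graphs subset_refl])
  also have "\<dots> = 1"
    by (simp add: sum_ennreal graph_prob_nonneg sum_graph_prob)
  finally show ?thesis using s by (auto simp: random_graph_def intro: prob_spaceI)
qed

lemma measure_vertex_edge_random_graph:
  assumes "E \<in> simple_graphs n"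
  shows "measure (vertex_edge_random_graph n M \<phi>) {E} = graph_prob n M \<phi> E"
  unfolding vertex_edge_random_graph_def measure_def
  using assms by (simp add: emeasure_point_measure_finite finite_simple_graphs graph_prob_nonneg)

end

end

(* Probabilistic method: let H be drawn from G(m, M, phi), and let the vertex random graph sample
   n vertices of H uniformly with replacement and take the induced graph (two vertices of the
   sample that coincide are not joined).  The probability that it equals E is the density of maps
   f : [n] -> [m] with induced graph E.  Two injections f, g with disjoint images pull H back to
   independent copies of G(n, M, phi), so only the O(n^2/m) fraction of the pairs (f, g) that are
   not of this kind contributes to the mean square deviation of this density from P(G = E).
   Hence for large m some fixed H is good for all E simultaneously. *)
theory Submission
  imports Defs
begin

section \<open>Bernoulli weights on finite sets\<close>

text \<open>For \<open>C\<close> inside a finite \<open>A\<close>: the chance that a random subset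
  of \<open>A\<close>, containing each \<open>e\<close> independently with probability
  \<open>w e\<close>, is exactly \<open>C\<close>.\<close>

definition bernoulli_weight :: "('e \<Rightarrow> real) \<Rightarrow> 'e set \<Rightarrow> 'e set \<Rightarrow> real" where
  "bernoulli_weight w A C = (\<Prod>e\<in>C. w e) * (\<Prod>e\<in>A - C. 1 - w e)"

text \<open>Independence of disjoint blocks: both products split along the union. This is the source
  of all conditional independence of edges below.\<close>

lemma bernoulli_weight_Un:
  assumes "finite A" "finite B" "A \<inter> B = {}" "C \<subseteq> A" "D \<subseteq> B"
  shows "bernoulli_weight w (A \<union> B) (C \<union> D) = bernoulli_weight w A C * bernoulli_weight w B D"
proof -
  have fin: "finite C" "finite D" using assms by (auto intro: finite_subset)
  have "(A \<union> B) - (C \<union> D) = (A - C) \<union> (B - D)" using assms by blast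
  moreover have "(\<Prod>e\<in>(A - C) \<union> (B - D). 1 - w e) = (\<Prod>e\<in>A - C. 1 - w e) * (\<Prod>e\<in>B - D. 1 - w e)"
    using assms by (intro prod.union_disjoint) auto
  moreover have "(\<Prod>e\<in>C \<union> D. w e) = (\<Prod>e\<in>C. w e) * (\<Prod>e\<in>D. w e)"
    using assms fin by (intro prod.union_disjoint) auto
  ultimately show ?thesis by (simp add: bernoulli_weight_def)
qed

lemma bernoulli_weight_image:
  assumes "inj_on h A" "C \<subseteq> A"
  shows "bernoulli_weight w (h ` A) (h ` C) = bernoulli_weight (w \<circ> h) A C"
proof -
  have "h ` A - h ` C = h ` (A - C)" using assms by (simp add: inj_on_image_set_diff)
  moreover have "inj_on h C" "inj_on h (A - C)" using assms by (auto intro: inj_on_subset)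
  ultimately show ?thesis by (simp add: bernoulli_weight_def prod.reindex)
qed

lemma bernoulli_weight_cong:
  assumes "\<And>e. e \<in> A \<Longrightarrow> w e = w' e" "C \<subseteq> A"
  shows "bernoulli_weight w A C = bernoulli_weight w' A C"
  unfolding bernoulli_weight_def using assms
  by (intro arg_cong2[where f = "(*)"] prod.cong) auto

lemma sum_bernoulli_weight:
  assumes "finite A"
  shows "(\<Sum>C\<in>Pow A. bernoulli_weight w A C) = 1"
  unfolding bernoulli_weight_def
  \<comment> \<open>Expanding the product of \<open>w e + (1 - w e)\<close> over \<open>A\<close>
    gives one summand for each subset of \<open>A\<close>.\<close>
  by (subst prod_add[OF assms, symmetric]) simp

text \<open>Marginalisation: a set with trace \<open>C\<close> on \<open>A\<close> is
  \<open>C \<union> D\<close> for a unique \<open>D \<subseteq> T - A\<close>, and the weights of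
  the free part \<open>D\<close> sum to 1.\<close>

lemma sum_bernoulli_weight_cylinder:
  assumes "finite T" "A \<subseteq> T" "C \<subseteq> A"
  shows "(\<Sum>H\<in>{H \<in> Pow T. H \<inter> A = C}. bernoulli_weight w T H) = bernoulli_weight w A C"
proof -
  have fin: "finite A" "finite (T - A)" using assms by (auto intro: finite_subset)
  have "(\<Sum>H\<in>{H \<in> Pow T. H \<inter> A = C}. bernoulli_weight w T H)
      = (\<Sum>D\<in>Pow (T - A). bernoulli_weight w T (C \<union> D))"
    using assms
    by (intro sum.reindex_bij_witness[of _ "\<lambda>D. C \<union> D" "\<lambda>H. H - A"])
      (auto intro!: arg_cong[where f = "bernoulli_weight w T"])
  also have "\<dots> = (\<Sum>D\<in>Pow (T - A). bernoulli_weight w A C * bernoulli_weight w (T - A) D)"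
  proof (intro sum.cong refl)
    fix D assume "D \<in> Pow (T - A)"
    then have "bernoulli_weight w (A \<union> (T - A)) (C \<union> D)
        = bernoulli_weight w A C * bernoulli_weight w (T - A) D"
      using assms fin by (intro bernoulli_weight_Un) auto
    moreover have "A \<union> (T - A) = T" using assms by auto
    ultimately show "bernoulli_weight w T (C \<union> D)
        = bernoulli_weight w A C * bernoulli_weight w (T - A) D" by simp
  qed
  also have "\<dots> = bernoulli_weight w A C"
    by (simp add: sum_distrib_left[symmetric] sum_bernoulli_weight fin)
  finally show ?thesis .
qed

section \<open>Induced graphs\<close>

definition all_edges :: "nat \<Rightarrow> edge_set" where
  "all_edges n = {e. e \<subseteq> {1..n} \<and> card e = 2}"

text \<open>A pullback along an arbitrary map. If \<open>f\<close> identifies the ends of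
  \<open>e\<close>, then the image of \<open>e\<close> is a singleton, which is not in
  \<open>H\<close> when \<open>H\<close> has only two-element members; so coinciding samples are not
  joined.\<close>

definition induced_graph :: "nat \<Rightarrow> (nat \<Rightarrow> 'b) \<Rightarrow> 'b set set \<Rightarrow> edge_set" where
  "induced_graph n f H = {e \<in> all_edges n. f ` e \<in> H}"

lemma simple_graphs_eq_Pow: "simple_graphs n = Pow (all_edges n)"
  by (auto simp: simple_graphs_def all_edges_def)

lemma finite_all_edges: "finite (all_edges n)"
  by (rule finite_subset[of _ "Pow {1..n}"]) (auto simp: all_edges_def)

lemma inj_on_image_all_edges:
  assumes "inj_on f {1..n}"
  shows "inj_on ((`) f) (all_edges n)"
  using inj_on_image_Pow[OF assms] by (rule inj_on_subset) (auto simp: all_edges_def)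

lemma image_all_edges_subset:
  assumes "inj_on f {1..n}" "f ` {1..n} \<subseteq> {1..m}"
  shows "(`) f ` all_edges n \<subseteq> all_edges m"
proof
  fix e' assume "e' \<in> (`) f ` all_edges n"
  then obtain e where e: "e' = f ` e" "e \<subseteq> {1..n}" "card e = 2" by (auto simp: all_edges_def)
  have "card (f ` e) = card e" using assms(1) e by (intro card_image) (rule inj_on_subset)
  then show "e' \<in> all_edges m" using e assms(2) by (auto simp: all_edges_def)
qed

text \<open>Turns the event that \<open>f\<close> induces \<open>E\<close> into a cylinder event,
  one that prescribes \<open>H\<close> on a fixed set of edges. An injective \<open>f\<close> is
  injective on edges too, so edge sets may be compared through their images.\<close>

lemma induced_graph_eq_iff:
  assumes "inj_on f {1..n}" "E \<subseteq> all_edges n"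
  shows "induced_graph n f H = E \<longleftrightarrow> H \<inter> (`) f ` all_edges n = (`) f ` E"
proof -
  have "H \<inter> (`) f ` all_edges n = (`) f ` induced_graph n f H"
    by (auto simp: induced_graph_def)
  moreover have "induced_graph n f H \<subseteq> all_edges n" by (auto simp: induced_graph_def)
  ultimately show ?thesis
    using inj_on_image_eq_iff[OF inj_on_image_all_edges[OF assms(1)]] assms(2) by metis
qed

text \<open>Min and Max pick an orientation of the edge, so that a weight is defined without
  assuming that the kernel is symmetric; symmetry only enters for reindexing by a non-monotone map.\<close>

definition edge_weight :: "('a \<Rightarrow> 'a \<Rightarrow> real) \<Rightarrow> (nat \<Rightarrow> 'a) \<Rightarrow> nat set \<Rightarrow> real" where
  "edge_weight \<phi> x e = \<phi> (x (Min e)) (x (Max e))"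

lemma all_edgesE:
  assumes "e \<in> all_edges n"
  obtains i j where "e = {i, j}" "1 \<le> i" "i < j" "j \<le> n"
proof -
  obtain i j where ij: "e = {i, j}" "i \<noteq> j" using assms by (auto simp: all_edges_def card_2_iff)
  then have "i \<in> {1..n}" "j \<in> {1..n}" using assms by (auto simp: all_edges_def)
  then show ?thesis using ij that[of i j] that[of j i] by (cases "i < j") (auto simp: insert_commute)
qed

text \<open>Passes from ordered pairs \<open>i < j\<close> to unordered edges, because an arbitrary
  injection carries edges to edges but need not preserve the order of a pair.\<close>

lemma conditional_graph_prob_eq_bernoulli_weight:
  assumes "E \<in> simple_graphs n"
  shows "conditional_graph_prob n \<phi> x E = bernoulli_weight (edge_weight \<phi> x) (all_edges n) E"
proof -
  let ?e = "\<lambda>(i::nat, j). {i, j}"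
  have E: "E \<subseteq> all_edges n" using assms by (simp add: simple_graphs_eq_Pow)
  have inj: "inj_on ?e (vertex_pairs n)"
    by (auto simp: inj_on_def vertex_pairs_def doubleton_eq_iff)
  \<comment> \<open>One reindexing serves both products: \<open>h\<close> is the identity on the
    edges in \<open>E\<close> and \<open>1 - t\<close> on those outside.\<close>
  have pairs: "(\<Prod>(i, j)\<in>{(i, j)\<in>vertex_pairs n. Q {i, j}}. h (\<phi> (x i) (x j)))
      = (\<Prod>e\<in>{e \<in> all_edges n. Q e}. h (edge_weight \<phi> x e))" for h :: "real \<Rightarrow> real" and Q
  proof -
    have "bij_betw ?e {(i, j)\<in>vertex_pairs n. Q {i, j}} {e \<in> all_edges n. Q e}"
    proof (rule bij_betw_imageI)
      show "inj_on ?e {(i, j)\<in>vertex_pairs n. Q {i, j}}"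
        using inj by (rule inj_on_subset) auto
      show "?e ` {(i, j)\<in>vertex_pairs n. Q {i, j}} = {e \<in> all_edges n. Q e}"
      proof (intro equalityI subsetI)
        fix e assume "e \<in> {e \<in> all_edges n. Q e}"
        then have "e \<in> all_edges n" "Q e" by auto
        then obtain i j where "e = {i, j}" "1 \<le> i" "i < j" "j \<le> n" by (auto elim: all_edgesE)
        then show "e \<in> ?e ` {(i, j)\<in>vertex_pairs n. Q {i, j}}"
          using \<open>Q e\<close> by (intro image_eqI[of _ _ "(i, j)"]) (auto simp: vertex_pairs_def)
      qed (auto simp: vertex_pairs_def all_edges_def)
    qed
    then have "(\<Prod>e\<in>{e \<in> all_edges n. Q e}. h (edge_weight \<phi> x e))
        = (\<Prod>p\<in>{(i, j)\<in>vertex_pairs n. Q {i, j}}. h (edge_weight \<phi> x (?e p)))"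
      by (rule prod.reindex_bij_betw[symmetric])
    also have "\<dots> = (\<Prod>(i, j)\<in>{(i, j)\<in>vertex_pairs n. Q {i, j}}. h (\<phi> (x i) (x j)))"
      by (rule prod.cong) (auto simp: edge_weight_def vertex_pairs_def min_def max_def)
    finally show ?thesis by simp
  qed
  have sets: "{e \<in> all_edges n. e \<in> E} = E" "{e \<in> all_edges n. e \<notin> E} = all_edges n - E"
    using E by auto
  show ?thesis
    using pairs[of "\<lambda>t. t" "\<lambda>e. e \<in> E"] pairs[of "\<lambda>t. 1 - t" "\<lambda>e. e \<notin> E"]
    unfolding conditional_graph_prob_def bernoulli_weight_def sets by simp
qed

lemma conditional_graph_prob_cong:
  assumes "\<And>i. i \<in> {1..n} \<Longrightarrow> x i = y i"
  shows "conditional_graph_prob n \<phi> x E = conditional_graph_prob n \<phi> y E"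
  unfolding conditional_graph_prob_def
  by (intro arg_cong2[where f = "(*)"] prod.cong) (auto simp: vertex_pairs_def assms)

lemma sum_conditional_graph_prob_cylinder:
  assumes "A \<subseteq> all_edges m" "C \<subseteq> A"
  shows "(\<Sum>H\<in>simple_graphs m. conditional_graph_prob m \<phi> x H * of_bool (H \<inter> A = C))
    = bernoulli_weight (edge_weight \<phi> x) A C"
proof -
  have "(\<Sum>H\<in>simple_graphs m. conditional_graph_prob m \<phi> x H * of_bool (H \<inter> A = C))
      = (\<Sum>H\<in>{H \<in> Pow (all_edges m). H \<inter> A = C}. bernoulli_weight (edge_weight \<phi> x) (all_edges m) H)"
    by (rule sum.mono_neutral_cong_right)
      (auto simp: finite_simple_graphs conditional_graph_prob_eq_bernoulli_weight
        simp flip: simple_graphs_eq_Pow)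
  then show ?thesis using sum_bernoulli_weight_cylinder[OF finite_all_edges assms] by simp
qed

text \<open>Two cylinder events on disjoint edge sets merge into a single one, to which the
  marginalisation applies.\<close>

lemma inter_Un_eq_iff:
  assumes "A \<inter> B = {}" "C \<subseteq> A" "D \<subseteq> B"
  shows "H \<inter> A = C \<and> H \<inter> B = D \<longleftrightarrow> H \<inter> (A \<union> B) = C \<union> D"
  using assms by blast

section \<open>Induced subgraphs conditionally on the vertex types\<close>

context vertex_edge_kernel
begin

lemma bernoulli_weight_induced:
  assumes x: "x \<in> space (\<Pi>\<^sub>M i\<in>{1..m}. M)" and f: "inj_on f {1..n}" "f ` {1..n} \<subseteq> {1..m}"
    and E: "E \<in> simple_graphs n"
  shows "bernoulli_weight (edge_weight \<phi> x) ((`) f ` all_edges n) ((`) f ` E)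
    = conditional_graph_prob n \<phi> (x \<circ> f) E"
proof -
  have E': "E \<subseteq> all_edges n" using E by (simp add: simple_graphs_eq_Pow)
  have "bernoulli_weight (edge_weight \<phi> x) ((`) f ` all_edges n) ((`) f ` E)
      = bernoulli_weight (edge_weight \<phi> x \<circ> (`) f) (all_edges n) E"
    by (rule bernoulli_weight_image[OF inj_on_image_all_edges[OF f(1)] E'])
  also have "\<dots> = bernoulli_weight (edge_weight \<phi> (x \<circ> f)) (all_edges n) E"
  proof (rule bernoulli_weight_cong[OF _ E'])
    fix e assume "e \<in> all_edges n"
    then obtain i j where ij: "e = {i, j}" "1 \<le> i" "i < j" "j \<le> n" by (rule all_edgesE)
    then have "i \<in> {1..n}" "j \<in> {1..n}" by auto
    then have "f i \<in> {1..m}" "f j \<in> {1..m}" using f(2) by blast+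
    then have "x (f i) \<in> space M" "x (f j) \<in> space M" using x by (auto simp: space_PiM)
    \<comment> \<open>\<open>f\<close> may reverse the order of \<open>i\<close> and
      \<open>j\<close>, and then \<open>Min\<close> and \<open>Max\<close> of the image edge read
      the kernel with its arguments exchanged.\<close>
    then have "\<phi> (x (f i)) (x (f j)) = \<phi> (x (f j)) (x (f i))" by (rule kernel_sym)
    then show "(edge_weight \<phi> x \<circ> (`) f) e = edge_weight \<phi> (x \<circ> f) e"
      using ij by (auto simp: edge_weight_def min_def max_def)
  qed
  finally show ?thesis by (simp add: conditional_graph_prob_eq_bernoulli_weight[OF E])
qed

text \<open>For fixed types the edges of \<open>H\<close> outside the image of \<open>f\<close> sum
  out, and what remains is a graph on \<open>n\<close> vertices with types
  \<open>x \<circ> f\<close>.\<close>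

lemma sum_conditional_graph_prob_induced:
  assumes x: "x \<in> space (\<Pi>\<^sub>M i\<in>{1..m}. M)" and f: "inj_on f {1..n}" "f ` {1..n} \<subseteq> {1..m}"
    and E: "E \<in> simple_graphs n"
  shows "(\<Sum>H\<in>simple_graphs m. conditional_graph_prob m \<phi> x H * of_bool (induced_graph n f H = E))
    = conditional_graph_prob n \<phi> (x \<circ> f) E"
proof -
  have E': "E \<subseteq> all_edges n" using E by (simp add: simple_graphs_eq_Pow)
  show ?thesis
    unfolding induced_graph_eq_iff[OF f(1) E'] bernoulli_weight_induced[OF x f E, symmetric]
    using E' image_all_edges_subset[OF f] by (intro sum_conditional_graph_prob_cylinder image_mono)
qed

text \<open>Images without a common vertex have no common edge, so the two events concern disjoint
  edge sets and are independent given the types.\<close>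

lemma sum_conditional_graph_prob_induced2:
  assumes x: "x \<in> space (\<Pi>\<^sub>M i\<in>{1..m}. M)"
    and f: "inj_on f {1..n}" "f ` {1..n} \<subseteq> {1..m}"
    and g: "inj_on g {1..n}" "g ` {1..n} \<subseteq> {1..m}"
    and disj: "f ` {1..n} \<inter> g ` {1..n} = {}"
    and E: "E \<in> simple_graphs n"
  shows "(\<Sum>H\<in>simple_graphs m. conditional_graph_prob m \<phi> x H *
      (of_bool (induced_graph n f H = E) * of_bool (induced_graph n g H = E)))
    = conditional_graph_prob n \<phi> (x \<circ> f) E * conditional_graph_prob n \<phi> (x \<circ> g) E"
proof -
  let ?A = "(`) f ` all_edges n" and ?B = "(`) g ` all_edges n"
  let ?C = "(`) f ` E" and ?D = "(`) g ` E"
  have E': "E \<subseteq> all_edges n" using E by (simp add: simple_graphs_eq_Pow)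
  \<comment> \<open>Edges are nonempty, so a common edge would yield a common vertex of the two
    images.\<close>
  have AB: "?A \<inter> ?B = {}"
  proof -
    have False if e: "e \<in> all_edges n" "e' \<in> all_edges n" "f ` e = g ` e'" for e e'
    proof -
      obtain i j where "e = {i, j}" "1 \<le> i" "i < j" "j \<le> n" by (rule all_edgesE[OF e(1)])
      then have "f i \<in> f ` {1..n}" "f i \<in> g ` e'" using e(3) by auto
      moreover have "g ` e' \<subseteq> g ` {1..n}" using e(2) by (auto simp: all_edges_def)
      ultimately show False using disj by auto
    qed
    then show ?thesis by auto
  qed
  have CD: "?C \<subseteq> ?A" "?D \<subseteq> ?B" using E' by auto
  have iff: "H \<inter> ?A = ?C \<and> H \<inter> ?B = ?D \<longleftrightarrow> H \<inter> (?A \<union> ?B) = ?C \<union> ?D" for H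
    by (rule inter_Un_eq_iff[OF AB CD])
  have "of_bool (induced_graph n f H = E) * of_bool (induced_graph n g H = E)
      = (of_bool (H \<inter> (?A \<union> ?B) = ?C \<union> ?D) :: real)" for H
    unfolding induced_graph_eq_iff[OF f(1) E'] induced_graph_eq_iff[OF g(1) E'] of_bool_conj[symmetric] iff ..
  then have "(\<Sum>H\<in>simple_graphs m. conditional_graph_prob m \<phi> x H *
      (of_bool (induced_graph n f H = E) * of_bool (induced_graph n g H = E)))
      = bernoulli_weight (edge_weight \<phi> x) (?A \<union> ?B) (?C \<union> ?D)"
    using CD image_all_edges_subset[OF f] image_all_edges_subset[OF g]
    by (simp only:) (intro sum_conditional_graph_prob_cylinder Un_least Un_mono)
  also have "\<dots> = bernoulli_weight (edge_weight \<phi> x) ?A ?C * bernoulli_weight (edge_weight \<phi> x) ?B ?D"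
    using AB CD by (intro bernoulli_weight_Un) (auto simp: finite_all_edges)
  finally show ?thesis
    using bernoulli_weight_induced[OF x f E] bernoulli_weight_induced[OF x g E] by simp
qed

section \<open>Averaging over the types: relabelling and independence\<close>

lemma prob_space_vertices: "prob_space (\<Pi>\<^sub>M i\<in>I. M)"
  by (intro prob_space_PiM prob_space_axioms)

lemma integrable_conditional_graph_prob:
  "integrable (\<Pi>\<^sub>M i\<in>{1..n}. M) (\<lambda>x. conditional_graph_prob n \<phi> x E)"
proof -
  interpret P: prob_space "\<Pi>\<^sub>M i\<in>{1..n}. M" by (rule prob_space_vertices)
  show ?thesis
    using conditional_graph_prob_bounds[of _ n E]
    by (intro P.integrable_const_bound[of _ 1] AE_I2 conditional_graph_prob_measurable) auto
qed

lemma measurable_reindex: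
  assumes "f ` {1..n} \<subseteq> {1..m}"
  shows "(\<lambda>x. \<lambda>i\<in>{1..n}. x (f i)) \<in> (\<Pi>\<^sub>M i\<in>{1..m}. M) \<rightarrow>\<^sub>M (\<Pi>\<^sub>M i\<in>{1..n}. M)"
  using assms by (intro measurable_restrict measurable_component_singleton) blast

text \<open>Coordinates picked along an injection are again independent draws from \<open>M\<close>,
  since no draw is used twice.\<close>

lemma distr_reindex:
  assumes "inj_on f {1..n}" "f ` {1..n} \<subseteq> {1..m}"
  shows "distr (\<Pi>\<^sub>M i\<in>{1..m}. M) (\<Pi>\<^sub>M i\<in>{1..n}. M) (\<lambda>x. \<lambda>i\<in>{1..n}. x (f i)) = (\<Pi>\<^sub>M i\<in>{1..n}. M)"
  using assms by (intro distr_PiM_reindex prob_space_axioms) blast+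

text \<open>\<open>x \<circ> f\<close> need not be a point of the product space, as it may take
  arbitrary values outside \<open>{1..n}\<close>; its restriction is one, and the edges see no other
  coordinates.\<close>

lemma conditional_graph_prob_reindex:
  "conditional_graph_prob n \<phi> (x \<circ> f) E = conditional_graph_prob n \<phi> (\<lambda>i\<in>{1..n}. x (f i)) E"
  by (rule conditional_graph_prob_cong) auto

lemma
  fixes m :: nat
  assumes f: "inj_on f {1..n}" "f ` {1..n} \<subseteq> {1..m}"
  shows integral_conditional_graph_prob_reindex:
      "(\<integral>x. conditional_graph_prob n \<phi> (x \<circ> f) E \<partial>(\<Pi>\<^sub>M i\<in>{1..m}. M)) = graph_prob n M \<phi> E"
    and integrable_conditional_graph_prob_reindex:
      "integrable (\<Pi>\<^sub>M i\<in>{1..m}. M) (\<lambda>x. conditional_graph_prob n \<phi> (x \<circ> f) E)"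
proof -
  show "(\<integral>x. conditional_graph_prob n \<phi> (x \<circ> f) E \<partial>(\<Pi>\<^sub>M i\<in>{1..m}. M)) = graph_prob n M \<phi> E"
    unfolding conditional_graph_prob_reindex graph_prob_def
    using integral_distr[OF measurable_reindex[OF f(2)] conditional_graph_prob_measurable]
    unfolding distr_reindex[OF f] by (rule sym)
  show "integrable (\<Pi>\<^sub>M i\<in>{1..m}. M) (\<lambda>x. conditional_graph_prob n \<phi> (x \<circ> f) E)"
    unfolding conditional_graph_prob_reindex
    using integrable_distr[OF measurable_reindex[OF f(2)], of "\<lambda>x. conditional_graph_prob n \<phi> x E"]
    unfolding distr_reindex[OF f] using integrable_conditional_graph_prob by blast
qed

lemma indep_vars_coordinates:
  fixes m :: nat
  shows "prob_space.indep_vars (\<Pi>\<^sub>M i\<in>{1..m}. M) (\<lambda>_. M) (\<lambda>i x. x i) {1..m}"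
\<comment> \<open>The characterisation of independence by the joint law asks for a nonempty index
  set; the empty family is independent by definition.\<close>
proof (cases "m = 0")
  case True
  interpret P: prob_space "\<Pi>\<^sub>M i\<in>{1..m}. M" by (rule prob_space_vertices)
  show ?thesis using True unfolding P.indep_vars_def P.indep_sets_def by auto
next
  case False
  interpret P: prob_space "\<Pi>\<^sub>M i\<in>{1..m}. M" by (rule prob_space_vertices)
  have "distr (\<Pi>\<^sub>M i\<in>{1..m}. M) (\<Pi>\<^sub>M i\<in>{1..m}. M) (\<lambda>x. \<lambda>i\<in>{1..m}. x i)
      = distr (\<Pi>\<^sub>M i\<in>{1..m}. M) (\<Pi>\<^sub>M i\<in>{1..m}. M) (\<lambda>x. x)"
    by (rule distr_cong) (auto simp: space_PiM)
  also have "\<dots> = (\<Pi>\<^sub>M i\<in>{1..m}. M)" by simp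
  also have "\<dots> = (\<Pi>\<^sub>M i\<in>{1..m}. distr (\<Pi>\<^sub>M i\<in>{1..m}. M) M (\<lambda>x. x i))"
    by (intro PiM_cong refl distr_PiM_component[symmetric] prob_space_axioms)
  finally show ?thesis
    using False by (subst P.indep_vars_iff_distr_eq_PiM') auto
qed

text \<open>The two factors depend on disjoint blocks of independent types, so the expectation of
  the product splits, and each factor has mean \<open>graph_prob n M \<phi> E\<close>.\<close>

lemma integral_conditional_graph_prob_disjoint:
  fixes m :: nat
  assumes f: "inj_on f {1..n}" "f ` {1..n} \<subseteq> {1..m}"
    and g: "inj_on g {1..n}" "g ` {1..n} \<subseteq> {1..m}"
    and disj: "f ` {1..n} \<inter> g ` {1..n} = {}"
  shows "(\<integral>x. conditional_graph_prob n \<phi> (x \<circ> f) E * conditional_graph_prob n \<phi> (x \<circ> g) E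
      \<partial>(\<Pi>\<^sub>M i\<in>{1..m}. M)) = (graph_prob n M \<phi> E)\<^sup>2"
proof -
  interpret P: prob_space "\<Pi>\<^sub>M i\<in>{1..m}. M" by (rule prob_space_vertices)
  \<comment> \<open>\<open>?F h\<close> reads only the coordinates in the image of \<open>h\<close>,
    so it is a function on the smaller product over that image, as independence of blocks
    requires.\<close>
  let ?F = "\<lambda>(h :: nat \<Rightarrow> nat) y. conditional_graph_prob n \<phi> (\<lambda>i\<in>{1..n}. y (h i)) E"
  have meas: "?F h \<in> borel_measurable (\<Pi>\<^sub>M i\<in>h ` {1..n}. M)" for h :: "nat \<Rightarrow> nat"
    by (rule measurable_compose[OF _ conditional_graph_prob_measurable])
      (intro measurable_restrict measurable_component_singleton, auto)
  have "P.indep_var (\<Pi>\<^sub>M i\<in>f ` {1..n}. M) (\<lambda>x. restrict (\<lambda>i. x i) (f ` {1..n}))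
      (\<Pi>\<^sub>M i\<in>g ` {1..n}. M) (\<lambda>x. restrict (\<lambda>i. x i) (g ` {1..n}))"
    by (rule P.indep_var_restrict[OF indep_vars_coordinates disj f(2) g(2)])
  from P.indep_var_compose[OF this meas[of f] meas[of g]]
  have "P.indep_var borel (?F f \<circ> (\<lambda>x. restrict (\<lambda>i. x i) (f ` {1..n})))
      borel (?F g \<circ> (\<lambda>x. restrict (\<lambda>i. x i) (g ` {1..n})))" .
  moreover have "?F h \<circ> (\<lambda>x. restrict (\<lambda>i. x i) (h ` {1..n}))
      = (\<lambda>x. conditional_graph_prob n \<phi> (x \<circ> h) E)" for h :: "nat \<Rightarrow> nat"
    by (auto intro!: ext conditional_graph_prob_cong)
  ultimately have "P.indep_var borel (\<lambda>x. conditional_graph_prob n \<phi> (x \<circ> f) E)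
      borel (\<lambda>x. conditional_graph_prob n \<phi> (x \<circ> g) E)" by (simp only:)
  then show ?thesis
    by (subst P.indep_var_lebesgue_integral)
      (simp_all add: integrable_conditional_graph_prob_reindex[OF f] integral_conditional_graph_prob_reindex[OF f]
        integrable_conditional_graph_prob_reindex[OF g] integral_conditional_graph_prob_reindex[OF g]
        power2_eq_square del: One_nat_def)
qed

text \<open>Lets identities that hold for each fixed choice of types be integrated; \<open>c\<close>
  will be an indicator or a product of two.\<close>

lemma sum_graph_prob_eq_integral:
  "(\<Sum>H\<in>simple_graphs m. graph_prob m M \<phi> H * c H)
    = (\<integral>x. (\<Sum>H\<in>simple_graphs m. conditional_graph_prob m \<phi> x H * c H) \<partial>(\<Pi>\<^sub>M i\<in>{1..m}. M))"
  unfolding graph_prob_def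
  by (subst Bochner_Integration.integral_sum)
    (simp_all add: integrable_conditional_graph_prob del: One_nat_def)

lemma sum_graph_prob_induced:
  assumes f: "inj_on f {1..n}" "f ` {1..n} \<subseteq> {1..m}" and E: "E \<in> simple_graphs n"
  shows "(\<Sum>H\<in>simple_graphs m. graph_prob m M \<phi> H * of_bool (induced_graph n f H = E))
    = graph_prob n M \<phi> E"
  unfolding sum_graph_prob_eq_integral integral_conditional_graph_prob_reindex[OF f, symmetric]
  by (intro Bochner_Integration.integral_cong refl sum_conditional_graph_prob_induced f E)

text \<open>With \<open>sum_graph_prob_induced\<close> this says that the indicators of
  \<open>f\<close> and \<open>g\<close> inducing \<open>E\<close> are uncorrelated when
  \<open>H\<close> is random.\<close>

lemma sum_graph_prob_induced2:
  assumes f: "inj_on f {1..n}" "f ` {1..n} \<subseteq> {1..m}"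
    and g: "inj_on g {1..n}" "g ` {1..n} \<subseteq> {1..m}"
    and disj: "f ` {1..n} \<inter> g ` {1..n} = {}"
    and E: "E \<in> simple_graphs n"
  shows "(\<Sum>H\<in>simple_graphs m. graph_prob m M \<phi> H *
      (of_bool (induced_graph n f H = E) * of_bool (induced_graph n g H = E)))
    = (graph_prob n M \<phi> E)\<^sup>2"
  unfolding sum_graph_prob_eq_integral integral_conditional_graph_prob_disjoint[OF f g disj, symmetric]
  by (intro Bochner_Integration.integral_cong refl sum_conditional_graph_prob_induced2 f g disj E)

end

section \<open>Counting pairs of maps with a collision\<close>

lemma card_mult_determined_coordinate_le:
  assumes "finite I" "finite A" "i \<in> I" "S \<subseteq> PiE I (\<lambda>_. A)"
    and det: "\<And>f g. f \<in> S \<Longrightarrow> g \<in> S \<Longrightarrow> (\<And>k. k \<in> I - {i} \<Longrightarrow> f k = g k) \<Longrightarrow> f i = g i"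
  shows "card A * card S \<le> card (PiE I (\<lambda>_. A))"
proof -
  \<comment> \<open>Overwriting coordinate \<open>i\<close> by any \<open>a\<close> loses nothing:
    the old value is determined by the other coordinates, so \<open>S\<close> has density at most
    \<open>1 / card A\<close>.\<close>
  let ?u = "\<lambda>(a, f). f(i := a)"
  have "inj_on ?u (A \<times> S)"
  proof (rule inj_onI)
    fix p q assume "p \<in> A \<times> S" "q \<in> A \<times> S" and upd: "?u p = ?u q"
    moreover obtain a f b g where pq: "p = (a, f)" "q = (b, g)" by (metis surj_pair)
    ultimately have S: "f \<in> S" "g \<in> S" and upd': "f(i := a) = g(i := b)" by auto
    have eq: "f k = g k" if "k \<noteq> i" for k using fun_cong[OF upd', of k] that by simp
    moreover have "f i = g i" by (rule det[OF S]) (simp add: eq)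
    ultimately have "f k = g k" for k by (cases "k = i") auto
    then have "f = g" by (rule ext)
    moreover have "a = b" using fun_cong[OF upd', of i] by simp
    ultimately show "p = q" using pq by simp
  qed
  moreover have "?u ` (A \<times> S) \<subseteq> PiE I (\<lambda>_. A)"
    using assms by (auto simp: PiE_iff extensional_def)
  moreover have "finite (PiE I (\<lambda>_. A))" using assms by (simp add: finite_PiE)
  ultimately have "card (A \<times> S) \<le> card (PiE I (\<lambda>_. A))" by (rule card_inj_on_le)
  then show ?thesis by (simp add: card_cartesian_product)
qed

definition disjoint_injections :: "nat \<Rightarrow> (nat \<Rightarrow> 'b) \<Rightarrow> (nat \<Rightarrow> 'b) \<Rightarrow> bool" where
  "disjoint_injections n f g \<longleftrightarrow>
     inj_on f {1..n} \<and> inj_on g {1..n} \<and> f ` {1..n} \<inter> g ` {1..n} = {}"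

text \<open>A union bound over the \<open>n\<^sup>2\<close> index pairs. A bad pair has a collision
  within \<open>f\<close>, within \<open>g\<close>, or between them, and each kind has density at
  most \<open>1 / card A\<close>; hence the constant 3.\<close>

lemma card_not_disjoint_injections_le:
  fixes A :: "'b set" and n :: nat
  assumes "finite A"
  defines "F \<equiv> PiE {1..n} (\<lambda>_. A)"
  shows "card A * card {(f, g) \<in> F \<times> F. \<not> disjoint_injections n f g} \<le> 3 * n\<^sup>2 * (card F)\<^sup>2"
proof -
  have finF: "finite F" using assms by (simp add: finite_PiE)
  \<comment> \<open>\<open>D (i, j)\<close> collects the maps that identify two distinct indices and
    is empty on the diagonal; \<open>B\<close> joins the three kinds of collision for one index
    pair.\<close>
  define D where "D = (\<lambda>(i, j). {f \<in> F. i \<noteq> j \<and> f i = f j})"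
  define B where "B = (\<lambda>p. D p \<times> F \<union> F \<times> D p \<union> (SIGMA f:F. {g \<in> F. g (snd p) = f (fst p)}))"
  have D: "card A * card (D p) \<le> card F" if "p \<in> {1..n} \<times> {1..n}" for p
  proof (cases "fst p = snd p")
    case True then show ?thesis by (simp add: D_def case_prod_unfold)
  next
    case False
    then show ?thesis unfolding F_def using that \<open>finite A\<close>
      by (intro card_mult_determined_coordinate_le[where i = "fst p"])
        (auto simp: D_def F_def)
  qed
  have E: "card A * card {g \<in> F. g j = a} \<le> card F" if "j \<in> {1..n}" for j a
    unfolding F_def using that \<open>finite A\<close>
    by (intro card_mult_determined_coordinate_le[where i = j]) auto
  have finD: "finite (D p)" for p using finF by (auto simp: D_def case_prod_unfold)
  have B: "card A * card (B p) \<le> 3 * (card F)\<^sup>2" if p: "p \<in> {1..n} \<times> {1..n}" for p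
  proof -
    let ?S = "SIGMA f:F. {g \<in> F. g (snd p) = f (fst p)}"
    have "card (B p) \<le> card (D p \<times> F) + card (F \<times> D p) + card ?S"
      unfolding B_def by (intro order_trans[OF card_Un_le] add_mono card_Un_le order_refl)
    also have "\<dots> = card (D p) * card F + card F * card (D p)
        + (\<Sum>f\<in>F. card {g \<in> F. g (snd p) = f (fst p)})"
      using finF by (simp add: card_cartesian_product card_SigmaI)
    finally have "card A * card (B p) \<le> card A * \<dots>" by (rule mult_left_mono) simp
    also have "\<dots> = (card A * card (D p)) * card F + card F * (card A * card (D p))
        + (\<Sum>f\<in>F. card A * card {g \<in> F. g (snd p) = f (fst p)})"
      by (simp add: algebra_simps sum_distrib_left)
    also have "\<dots> \<le> card F * card F + card F * card F + (\<Sum>f\<in>F. card F)"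
      using p by (intro add_mono mult_mono sum_mono D E) auto
    finally show ?thesis by (simp add: power2_eq_square)
  qed
  have "{(f, g) \<in> F \<times> F. \<not> disjoint_injections n f g} \<subseteq> (\<Union>p\<in>{1..n} \<times> {1..n}. B p)"
  proof clarify
    fix f g assume fg: "f \<in> F" "g \<in> F" "\<not> disjoint_injections n f g"
    then consider "\<not> inj_on f {1..n}" | "\<not> inj_on g {1..n}" | "f ` {1..n} \<inter> g ` {1..n} \<noteq> {}"
      by (auto simp: disjoint_injections_def)
    then show "(f, g) \<in> (\<Union>p\<in>{1..n} \<times> {1..n}. B p)"
    proof cases
      case 1
      then obtain i j where "i \<in> {1..n}" "j \<in> {1..n}" "i \<noteq> j" "f i = f j" by (auto simp: inj_on_def)
      then show ?thesis using fg by (intro UN_I[of "(i, j)"]) (auto simp: B_def D_def)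
    next
      case 2
      then obtain i j where "i \<in> {1..n}" "j \<in> {1..n}" "i \<noteq> j" "g i = g j" by (auto simp: inj_on_def)
      then show ?thesis using fg by (intro UN_I[of "(i, j)"]) (auto simp: B_def D_def)
    next
      case 3
      then obtain a where "a \<in> f ` {1..n}" "a \<in> g ` {1..n}" by blast
      then obtain i j where "i \<in> {1..n}" "j \<in> {1..n}" "a = f i" "a = g j" by blast
      then show ?thesis using fg by (intro UN_I[of "(i, j)"]) (auto simp: B_def D_def)
    qed
  qed
  moreover have "finite (B p)" for p using finF finD by (auto simp: B_def)
  ultimately have "card {(f, g) \<in> F \<times> F. \<not> disjoint_injections n f g}
      \<le> card (\<Union>p\<in>{1..n} \<times> {1..n}. B p)" by (intro card_mono) auto
  also have "\<dots> \<le> (\<Sum>p\<in>{1..n} \<times> {1..n}. card (B p))" by (intro card_UN_le) auto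
  finally have "card A * card {(f, g) \<in> F \<times> F. \<not> disjoint_injections n f g}
      \<le> card A * (\<Sum>p\<in>{1..n} \<times> {1..n}. card (B p))" by (rule mult_left_mono) simp
  also have "\<dots> = (\<Sum>p\<in>{1..n} \<times> {1..n}. card A * card (B p))" by (rule sum_distrib_left)
  also have "\<dots> \<le> (\<Sum>p\<in>{1..n} \<times> {1..n}. 3 * (card F)\<^sup>2)" by (intro sum_mono B)
  also have "\<dots> = 3 * n\<^sup>2 * (card F)\<^sup>2" by (simp add: card_cartesian_product power2_eq_square)
  finally show ?thesis .
qed

section \<open>Induced densities\<close>

text \<open>All maps count, not only injections, so that this is exactly a probability under
  sampling with replacement.\<close>

definition induced_density :: "nat \<Rightarrow> 'b set \<Rightarrow> 'b set set \<Rightarrow> edge_set \<Rightarrow> real" where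
  "induced_density n A H E =
     (\<Sum>f\<in>PiE {1..n} (\<lambda>_. A). of_bool (induced_graph n f H = E)) / real (card A) ^ n"

context vertex_edge_kernel
begin

lemma graph_prob_le_1:
  assumes "E \<in> simple_graphs n"
  shows "graph_prob n M \<phi> E \<le> 1"
proof -
  have "graph_prob n M \<phi> E \<le> (\<Sum>E\<in>simple_graphs n. graph_prob n M \<phi> E)"
    using assms by (intro member_le_sum graph_prob_nonneg finite_simple_graphs)
  then show ?thesis by (simp add: sum_graph_prob)
qed

text \<open>Both indicators are centred at \<open>p\<close>, although \<open>p\<close> need not be
  the mean for a map that is not injective. For disjoint injections the moments cancel exactly;
  otherwise both factors lie between -1 and 1.\<close>

lemma covariance_induced_le:
  assumes E: "E \<in> simple_graphs n"
    and f: "f \<in> PiE {1..n} (\<lambda>_. {1..m})" and g: "g \<in> PiE {1..n} (\<lambda>_. {1..m})"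
  defines "p \<equiv> graph_prob n M \<phi> E"
  shows "(\<Sum>H\<in>simple_graphs m. graph_prob m M \<phi> H *
      ((of_bool (induced_graph n f H = E) - p) * (of_bool (induced_graph n g H = E) - p)))
    \<le> of_bool (\<not> disjoint_injections n f g)"
proof (cases "disjoint_injections n f g")
  case True
  let ?q = "graph_prob m M \<phi>"
  let ?b = "\<lambda>f H. of_bool (induced_graph n f H = E) :: real"
  have f': "inj_on f {1..n}" "f ` {1..n} \<subseteq> {1..m}"
    and g': "inj_on g {1..n}" "g ` {1..n} \<subseteq> {1..m}"
    and disj: "f ` {1..n} \<inter> g ` {1..n} = {}"
    using True f g unfolding disjoint_injections_def by (auto simp del: atLeastAtMost_iff)
  \<comment> \<open>Expanding leaves \<open>p\<^sup>2 - p\<^sup>2 - p\<^sup>2 + p\<^sup>2\<close>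
    once the moments are inserted.\<close>
  have "(\<Sum>H\<in>simple_graphs m. ?q H * ((?b f H - p) * (?b g H - p)))
      = (\<Sum>H\<in>simple_graphs m. ?q H * (?b f H * ?b g H)) - p * (\<Sum>H\<in>simple_graphs m. ?q H * ?b f H)
        - p * (\<Sum>H\<in>simple_graphs m. ?q H * ?b g H) + p\<^sup>2 * (\<Sum>H\<in>simple_graphs m. ?q H)"
    unfolding sum_distrib_left sum_subtractf[symmetric] sum.distrib[symmetric]
    by (intro sum.cong refl) (simp add: algebra_simps power2_eq_square)
  also have "\<dots> = 0"
    unfolding sum_graph_prob_induced2[OF f' g' disj E] sum_graph_prob_induced[OF f' E]
      sum_graph_prob_induced[OF g' E] sum_graph_prob
    by (simp add: p_def power2_eq_square)
  finally show ?thesis by simp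
next
  case False
  have p: "0 \<le> p" "p \<le> 1" unfolding p_def by (simp_all add: graph_prob_nonneg graph_prob_le_1 E)
  have "(of_bool P - p) * (of_bool Q - p) \<le> 1" for P Q
  proof -
    have "\<bar>(of_bool P - p) * (of_bool Q - p)\<bar> \<le> 1 * 1"
      unfolding abs_mult using p by (intro mult_mono) (auto simp: abs_if)
    then show ?thesis by linarith
  qed
  then have "(\<Sum>H\<in>simple_graphs m. graph_prob m M \<phi> H *
      ((of_bool (induced_graph n f H = E) - p) * (of_bool (induced_graph n g H = E) - p)))
    \<le> (\<Sum>H\<in>simple_graphs m. graph_prob m M \<phi> H * 1)"
    by (intro sum_mono mult_left_mono graph_prob_nonneg)
  then show ?thesis using False by (simp add: sum_graph_prob)
qed

text \<open>The squared deviation is an average over pairs of maps; exchanging the sums bounds it by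
  the proportion of pairs that are not disjoint injections.\<close>

lemma second_moment_induced_density:
  assumes E: "E \<in> simple_graphs n" and m: "m > 0"
  shows "(\<Sum>H\<in>simple_graphs m. graph_prob m M \<phi> H *
      (induced_density n {1..m} H E - graph_prob n M \<phi> E)\<^sup>2) \<le> 3 * real n ^ 2 / real m"
proof -
  define F where "F = PiE {1..n} (\<lambda>_. {1..m})"
  define p where "p = graph_prob n M \<phi> E"
  let ?q = "graph_prob m M \<phi>"
  define d where "d = (\<lambda>(f :: nat \<Rightarrow> nat) H. of_bool (induced_graph n f H = E) - p)"
  have finF: "finite F" by (simp add: F_def finite_PiE)
  have cardF: "real (card F) = real m ^ n" by (simp add: F_def card_PiE)
  have pos: "real (card F) > 0" using m by (simp add: cardF)
  have dens: "induced_density n {1..m} H E - p = (\<Sum>f\<in>F. d f H) / real (card F)" for H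
    using pos unfolding induced_density_def d_def F_def[symmetric]
    by (simp add: sum_subtractf diff_divide_distrib flip: cardF)
  have square: "(\<Sum>f\<in>F. d f H)\<^sup>2 = (\<Sum>(f, g)\<in>F \<times> F. d f H * d g H)" for H
    by (simp add: power2_eq_square sum_product sum.cartesian_product)
  have "(\<Sum>H\<in>simple_graphs m. ?q H * (induced_density n {1..m} H E - p)\<^sup>2)
      = (\<Sum>H\<in>simple_graphs m. \<Sum>(f, g)\<in>F \<times> F. ?q H * (d f H * d g H)) / (real (card F))\<^sup>2"
    unfolding dens power_divide square
    by (simp add: sum_distrib_left sum_divide_distrib case_prod_unfold)
  also have "\<dots> = (\<Sum>(f, g)\<in>F \<times> F. \<Sum>H\<in>simple_graphs m. ?q H * (d f H * d g H)) / (real (card F))\<^sup>2"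
    by (subst sum.swap) (simp add: case_prod_unfold)
  also have "\<dots> \<le> (\<Sum>(f, g)\<in>F \<times> F. of_bool (\<not> disjoint_injections n f g)) / (real (card F))\<^sup>2"
    unfolding d_def p_def F_def
    by (intro divide_right_mono sum_mono) (auto intro!: covariance_induced_le E)
  also have "(\<Sum>(f, g)\<in>F \<times> F. of_bool (\<not> disjoint_injections n f g))
      = real (card {(f, g) \<in> F \<times> F. \<not> disjoint_injections n f g})"
  proof -
    have "{(f, g) \<in> F \<times> F. \<not> disjoint_injections n f g}
        = (F \<times> F) \<inter> {z. \<not> disjoint_injections n (fst z) (snd z)}" by auto
    then show ?thesis using finF by (simp add: case_prod_unfold sum_of_bool_eq)
  qed
  also have "\<dots> / (real (card F))\<^sup>2 \<le> 3 * real n ^ 2 / real m"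
  proof -
    have "card {1..m} * card {(f, g) \<in> F \<times> F. \<not> disjoint_injections n f g} \<le> 3 * n\<^sup>2 * (card F)\<^sup>2"
      unfolding F_def by (rule card_not_disjoint_injections_le) simp
    then have "real (m * card {(f, g) \<in> F \<times> F. \<not> disjoint_injections n f g})
        \<le> real (3 * n\<^sup>2 * (card F)\<^sup>2)" by (subst of_nat_le_iff) simp
    then show ?thesis using pos m by (simp add: field_simps)
  qed
  finally show ?thesis by (simp add: p_def)
qed

text \<open>A first-moment argument for the total squared error: some \<open>H\<close> does no worse
  than the average.\<close>

lemma exists_graph_induced_density_close:
  assumes "\<delta> > 0"
  obtains m H where "m > 0" "H \<in> simple_graphs m"
    "\<And>E. E \<in> simple_graphs n \<Longrightarrow> \<bar>induced_density n {1..m} H E - graph_prob n M \<phi> E\<bar> \<le> \<delta>"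
proof -
  let ?K = "real (card (simple_graphs n))"
  \<comment> \<open>Large enough to bring the second-moment bound, summed over all graphs on
    \<open>n\<close> vertices, below \<open>\<delta>\<^sup>2\<close>; the successor makes
    \<open>m\<close> positive.\<close>
  obtain m' :: nat where m': "?K * (3 * real n ^ 2) / \<delta>\<^sup>2 < real m'" using reals_Archimedean2 by blast
  define m where "m = Suc m'"
  have m: "m > 0" "?K * (3 * real n ^ 2 / real m) < \<delta>\<^sup>2"
    using m' assms by (auto simp: m_def field_simps intro: add_strict_increasing)
  let ?q = "graph_prob m M \<phi>"
  \<comment> \<open>Summing the errors over all \<open>E\<close> makes a single \<open>H\<close>
    serve every \<open>E\<close>, as each term is at most the sum.\<close>
  define Z where "Z = (\<lambda>H. \<Sum>E\<in>simple_graphs n. (induced_density n {1..m} H E - graph_prob n M \<phi> E)\<^sup>2)"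
  have "(\<Sum>H\<in>simple_graphs m. ?q H * Z H) = (\<Sum>E\<in>simple_graphs n. \<Sum>H\<in>simple_graphs m.
      ?q H * (induced_density n {1..m} H E - graph_prob n M \<phi> E)\<^sup>2)"
    unfolding Z_def sum_distrib_left by (rule sum.swap)
  also have "\<dots> \<le> (\<Sum>E\<in>simple_graphs n. 3 * real n ^ 2 / real m)"
    by (intro sum_mono second_moment_induced_density m)
  finally have less: "(\<Sum>H\<in>simple_graphs m. ?q H * Z H) < \<delta>\<^sup>2" using m by simp
  \<comment> \<open>The weights \<open>?q H\<close> sum to 1, so if every \<open>Z H\<close>
    exceeded \<open>\<delta>\<^sup>2\<close> their average would be at least
    \<open>\<delta>\<^sup>2\<close>.\<close>
  have "\<exists>H\<in>simple_graphs m. Z H \<le> \<delta>\<^sup>2"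
  proof (rule ccontr)
    assume "\<not> ?thesis"
    then have "(\<Sum>H\<in>simple_graphs m. ?q H * \<delta>\<^sup>2) \<le> (\<Sum>H\<in>simple_graphs m. ?q H * Z H)"
      by (intro sum_mono mult_left_mono graph_prob_nonneg) auto
    moreover have "(\<Sum>H\<in>simple_graphs m. ?q H * \<delta>\<^sup>2) = \<delta>\<^sup>2"
      by (simp add: sum_distrib_right[symmetric] sum_graph_prob)
    ultimately show False using less by simp
  qed
  then obtain H where H: "H \<in> simple_graphs m" "Z H \<le> \<delta>\<^sup>2" by blast
  have "\<bar>induced_density n {1..m} H E - graph_prob n M \<phi> E\<bar> \<le> \<delta>" if "E \<in> simple_graphs n" for E
  proof -
    have "(induced_density n {1..m} H E - graph_prob n M \<phi> E)\<^sup>2 \<le> Z H"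
      unfolding Z_def using that by (intro member_le_sum) (auto simp: finite_simple_graphs)
    then have "(induced_density n {1..m} H E - graph_prob n M \<phi> E)\<^sup>2 \<le> \<delta>\<^sup>2" using H by simp
    then show ?thesis using assms by (simp add: abs_le_square_iff[symmetric])
  qed
  then show thesis using that m H by blast
qed

end

section \<open>The vertex random graph of a finite graph\<close>

definition adjacency :: "'b set set \<Rightarrow> 'b \<Rightarrow> 'b \<Rightarrow> real" where
  "adjacency H a b = of_bool ({a, b} \<in> H)"

lemma vertex_kernel_adjacency:
  assumes "finite A" "A \<noteq> {}"
  shows "vertex_kernel (uniform_count_measure A) (adjacency H)"
proof -
  \<comment> \<open>On a finite set of types every subset of the square is measurable, hence every
    kernel is.\<close>
  have "sets (uniform_count_measure A \<Otimes>\<^sub>M uniform_count_measure A) = Pow (A \<times> A)"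
    using assms by (intro sets_pair_countable countable_finite) (simp_all add: sets_uniform_count_measure)
  moreover have "space (uniform_count_measure A \<Otimes>\<^sub>M uniform_count_measure A) = A \<times> A"
    by (simp add: space_pair_measure space_uniform_count_measure)
  ultimately have "case_prod (adjacency H)
      \<in> borel_measurable (uniform_count_measure A \<Otimes>\<^sub>M uniform_count_measure A)"
    by (auto simp: measurable_def)
  moreover have "prob_space (uniform_count_measure A)"
    using assms by (rule prob_space_uniform_count_measure)
  ultimately show ?thesis
    by (auto simp: vertex_kernel_def vertex_edge_kernel_def vertex_edge_kernel_axioms_def
        vertex_kernel_axioms_def adjacency_def insert_commute)
qed

text \<open>Both measures agree on boxes, whose cardinality is the product of those of the sides;
  this turns the integral over types into a plain average over maps.\<close>

lemma PiM_uniform_count_measure: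
  assumes "finite I" "finite A" "A \<noteq> {}"
  shows "(\<Pi>\<^sub>M i\<in>I. uniform_count_measure A) = uniform_count_measure (PiE I (\<lambda>_. A))"
proof -
  interpret U: prob_space "uniform_count_measure A"
    using assms by (intro prob_space_uniform_count_measure)
  interpret product_sigma_finite "\<lambda>_. uniform_count_measure A" by standard
  have fin: "finite (PiE I (\<lambda>_. A))" using assms by (simp add: finite_PiE)
  show ?thesis
  proof (rule PiM_eqI[symmetric])
    have "sets (\<Pi>\<^sub>M i\<in>I. uniform_count_measure A) = sets (\<Pi>\<^sub>M i\<in>I. count_space A)"
      by (intro sets_PiM_cong refl) (simp add: sets_uniform_count_measure)
    also have "\<dots> = Pow (PiE I (\<lambda>_. A))"
      using assms by (subst count_space_PiM_finite) (auto intro: countable_finite)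
    finally show "sets (uniform_count_measure (PiE I (\<lambda>_. A))) = sets (\<Pi>\<^sub>M i\<in>I. uniform_count_measure A)"
      by (simp add: sets_uniform_count_measure)
  next
    fix B assume "\<And>i. i \<in> I \<Longrightarrow> B i \<in> sets (uniform_count_measure A)"
    then have B: "\<And>i. i \<in> I \<Longrightarrow> B i \<subseteq> A" by (auto simp: sets_uniform_count_measure)
    then have "PiE I B \<subseteq> PiE I (\<lambda>_. A)" by (intro PiE_mono) auto
    then have "emeasure (uniform_count_measure (PiE I (\<lambda>_. A))) (PiE I B)
        = ennreal (real (card (PiE I B)) / real (card (PiE I (\<lambda>_. A))))"
      using fin by (intro emeasure_uniform_count_measure)
    also have "\<dots> = ennreal (\<Prod>i\<in>I. real (card (B i)) / real (card A))"
      using assms by (simp add: card_PiE prod_dividef)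
    also have "\<dots> = (\<Prod>i\<in>I. ennreal (real (card (B i)) / real (card A)))"
      by (subst prod_ennreal) auto
    also have "\<dots> = (\<Prod>i\<in>I. emeasure (uniform_count_measure A) (B i))"
      using assms B by (intro prod.cong refl) (simp add: emeasure_uniform_count_measure)
    finally show "emeasure (uniform_count_measure (PiE I (\<lambda>_. A))) (PiE I B)
        = (\<Prod>i\<in>I. emeasure (uniform_count_measure A) (B i))" .
  qed fact
qed

text \<open>With weights 0 and 1 the random edge set is deterministic and equals the induced
  graph.\<close>

lemma conditional_graph_prob_adjacency:
  assumes "E \<in> simple_graphs n"
  shows "conditional_graph_prob n (adjacency H) x E = of_bool (induced_graph n x H = E)"
proof -
  have E: "E \<subseteq> all_edges n" using assms by (simp add: simple_graphs_eq_Pow)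
  have "edge_weight (adjacency H) x e = of_bool (e \<in> induced_graph n x H)" if e: "e \<in> all_edges n" for e
  proof -
    obtain i j where "e = {i, j}" "1 \<le> i" "i < j" "j \<le> n" by (rule all_edgesE[OF e])
    then show ?thesis using e
      by (simp add: edge_weight_def adjacency_def induced_graph_def min_def max_def)
  qed
  then have "conditional_graph_prob n (adjacency H) x E
      = bernoulli_weight (\<lambda>e. of_bool (e \<in> induced_graph n x H)) (all_edges n) E"
    unfolding conditional_graph_prob_eq_bernoulli_weight[OF assms] using E
    by (intro bernoulli_weight_cong)
  also have "\<dots> = of_bool (induced_graph n x H = E)"
  proof (cases "induced_graph n x H = E")
    case True then show ?thesis by (simp add: bernoulli_weight_def)
  next
    case False
    \<comment> \<open>An edge on which the two graphs differ contributes a factor 0, to the first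
      product if it lies in \<open>E\<close> and to the second otherwise.\<close>
    then consider e where "e \<in> E" "e \<notin> induced_graph n x H"
      | e where "e \<in> all_edges n - E" "e \<in> induced_graph n x H"
      by (auto simp: induced_graph_def)
    then show ?thesis
    proof cases
      case 1
      then have "(\<Prod>e\<in>E. of_bool (e \<in> induced_graph n x H) :: real) = 0"
        using finite_subset[OF E finite_all_edges] by (intro prod_zero) auto
      then show ?thesis using False by (simp add: bernoulli_weight_def)
    next
      case 2
      then have "(\<Prod>e\<in>all_edges n - E. 1 - of_bool (e \<in> induced_graph n x H) :: real) = 0"
        using finite_all_edges[of n] by (intro prod_zero) auto
      then show ?thesis using False by (simp add: bernoulli_weight_def)
    qed
  qed
  finally show ?thesis .
qed

lemma graph_prob_adjacency:
  assumes "finite A" "A \<noteq> {}" "E \<in> simple_graphs n"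
  shows "graph_prob n (uniform_count_measure A) (adjacency H) E = induced_density n A H E"
  using assms
  by (simp add: graph_prob_def PiM_uniform_count_measure integral_uniform_count_measure finite_PiE
      conditional_graph_prob_adjacency induced_density_def card_PiE)

text \<open>Densities do not change under relabelling; this carries the graph from
  \<open>{1..m}\<close> to real vertex labels.\<close>

lemma induced_density_image:
  assumes h: "inj h"
  shows "induced_density n (h ` A) ((`) h ` H) E = induced_density n A H E"
proof -
  have inj: "inj_on h S" for S using h by (rule inj_on_subset) simp
  have "induced_graph n (\<lambda>i\<in>{1..n}. h (f i)) ((`) h ` H) = induced_graph n f H" for f
  proof -
    have "(\<lambda>i\<in>{1..n}. h (f i)) ` e \<in> (`) h ` H \<longleftrightarrow> f ` e \<in> H" if "e \<in> all_edges n" for e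
    proof -
      have "(\<lambda>i\<in>{1..n}. h (f i)) ` e = h ` f ` e"
        using that by (auto simp: all_edges_def image_image intro!: image_cong)
      then show ?thesis using inj_image_mem_iff[OF inj_on_image[of h UNIV]] inj
        by (auto simp: inj_image_eq_iff[OF h])
    qed
    then show ?thesis by (auto simp: induced_graph_def)
  qed
  \<comment> \<open>Maps into \<open>A\<close> correspond to maps into its copy by composing with
    \<open>h\<close>, the inverse being pointwise \<open>inv_into A h\<close>.\<close>
  moreover have "bij_betw (\<lambda>f. \<lambda>i\<in>{1..n}. h (f i)) (PiE {1..n} (\<lambda>_. A)) (PiE {1..n} (\<lambda>_. h ` A))"
    by (rule bij_betwI[where g = "\<lambda>f. \<lambda>i\<in>{1..n}. inv_into A h (f i)"])
      (auto simp: fun_eq_iff PiE_iff extensional_def inj inv_into_into f_inv_into_f)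
  ultimately have "(\<Sum>f\<in>PiE {1..n} (\<lambda>_. h ` A). of_bool (induced_graph n f ((`) h ` H) = E) :: real)
      = (\<Sum>f\<in>PiE {1..n} (\<lambda>_. A). of_bool (induced_graph n f H = E))"
    by (subst sum.reindex_bij_betw[symmetric]) auto
  then show ?thesis by (simp add: induced_density_def card_image[OF inj])
qed

theorem theorem3p3:
  fixes n :: nat and \<epsilon> :: real and G :: "edge_set measure"
  assumes "n \<ge> 1"
    and "is_vertex_edge_random_graph TYPE('a) n G"
    and "\<epsilon> > 0"
  shows "\<exists>G'. is_vertex_random_graph TYPE(real) n G' \<and> tv_dist n G G' < \<epsilon>"
proof -
  obtain M :: "'a measure" and \<phi> where k: "vertex_edge_kernel M \<phi>"
    and G: "G = vertex_edge_random_graph n M \<phi>"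
    using assms(2) by (auto simp: is_vertex_edge_random_graph_def)
  interpret K: vertex_edge_kernel M \<phi> by (rule k)
  let ?K = "real (card (simple_graphs n))"
  \<comment> \<open>The empty graph is always there, so the tolerance can be shared out among the
    graphs.\<close>
  have K: "?K > 0" using finite_simple_graphs[of n]
    by (auto simp: card_gt_0_iff simple_graphs_eq_Pow)
  obtain m H where m: "m > 0" "H \<in> simple_graphs m" and
    close: "\<And>E. E \<in> simple_graphs n \<Longrightarrow>
      \<bar>induced_density n {1..m} H E - graph_prob n M \<phi> E\<bar> \<le> \<epsilon> / ?K"
    using K.exists_graph_induced_density_close[of "\<epsilon> / ?K" n] K assms(3) by auto
  \<comment> \<open>The good graph is copied into the reals because the claim fixes
    \<open>real\<close> as the type of vertex labels.\<close>
  define A where "A = real ` {1..m}"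
  define H' where "H' = (`) real ` H"
  define G' where "G' = vertex_edge_random_graph n (uniform_count_measure A) (adjacency H')"
  have A: "finite A" "A \<noteq> {}" using m by (auto simp: A_def)
  interpret V: vertex_kernel "uniform_count_measure A" "adjacency H'"
    by (rule vertex_kernel_adjacency[OF A])
  have "\<bar>measure G {E} - measure G' {E}\<bar> \<le> \<epsilon> / ?K" if E: "E \<in> simple_graphs n" for E
  proof -
    have "measure G' {E} = induced_density n A H' E"
      unfolding G'_def V.measure_vertex_edge_random_graph[OF E] by (rule graph_prob_adjacency[OF A E])
    also have "\<dots> = induced_density n {1..m} H E"
      unfolding A_def H'_def by (rule induced_density_image) (simp add: inj_on_def)
    finally show ?thesis
      using close[OF E] by (simp add: G K.measure_vertex_edge_random_graph[OF E] abs_minus_commute)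
  qed
  then have "(\<Sum>E\<in>simple_graphs n. \<bar>measure G {E} - measure G' {E}\<bar>) \<le> ?K * (\<epsilon> / ?K)"
    by (rule sum_bounded_above)
  \<comment> \<open>The factor 1/2 in the distance leaves at most half of \<open>\<epsilon>\<close>,
    so bounds that are not strict give a strict one.\<close>
  then have "tv_dist n G G' < \<epsilon>" using K assms(3) by (simp add: tv_dist_def)
  moreover have "is_vertex_random_graph TYPE(real) n G'"
    unfolding is_vertex_random_graph_def G'_def using V.vertex_kernel_axioms by blast
  ultimately show ?thesis by blast
qed

end
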